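(* Let $\mathcal S$ satisfy Axioms I–III, and suppose that for every pair $a\neq b$ in $\mathcal S$ there exist orthogonal $c,c'\in\mathcal S$ and a number $\lambda$ with $\frac12\le\lambda\le1$ such that $\frac12(a+b)=\lambda c+(1-\lambda)c'$ as functions on $\mathcal S$. Then the function $p$ cannot be reproduced by a local hidden variable model unless $\mathcal S$ is classical, i.e. unless $p$ only assumes the values $0$ and $1$.
   Context: Setting: $\mathcal S$ is a set with a function $p:\mathcal S\times\mathcal S\to[0,1]$; write $x(y)=p(x,y)$ and identify an element $u\in\mathcal S$ with the function $u(\cdot)$ on $\mathcal S$. Elements $u,v$ are orthogonal if $u(v)=0$. Put $d(x,y)=\sup_{z\in\mathcal S}|x(z)-y(z)|$. A frame in $\mathcal S$ is a maximal set of mutually orthogonal elements of $\mathcal S$. Axiom I: for all $w,z\in\mathcal S$, $w(z)=1$ if and only if $w=z$, and $w(z)=z(w)$. Axiom II: $\mathcal S$ is compact in the metric $d$. Axiom III: for every $a\in\mathcal S$ and every frame $\{x_1,x_2,\dots\}$ in $\mathcal S$, $\sum_j a(x_j)=1$. A local hidden variable model reproducing $p$ consists of a set $\Lambda$ with a measure $\mu$ and measurable subsets $\Lambda(x)\subseteq\Lambda$ for $x\in\mathcal S$ such that $\mu(\Lambda(x))=1$ for all $x$ and $p(x,y)=\mu(\Lambda(x)\cap\Lambda(y))$ for all $x,y\in\mathcal S$. *)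

theory Defs
  imports "HOL-Analysis.Analysis"
begin

definition orthogonal_in :: "('a \<Rightarrow> 'a \<Rightarrow> real) \<Rightarrow> 'a \<Rightarrow> 'a \<Rightarrow> bool" where
  "orthogonal_in p u v \<longleftrightarrow> p u v = 0"

definition orthogonal_set :: "'a set \<Rightarrow> ('a \<Rightarrow> 'a \<Rightarrow> real) \<Rightarrow> 'a set \<Rightarrow> bool" where
  "orthogonal_set S p F \<longleftrightarrow> F \<subseteq> S \<and> pairwise (orthogonal_in p) F"

definition frame :: "'a set \<Rightarrow> ('a \<Rightarrow> 'a \<Rightarrow> real) \<Rightarrow> 'a set \<Rightarrow> bool" where
  "frame S p F \<longleftrightarrow> orthogonal_set S p F \<and> (\<forall>G. orthogonal_set S p G \<longrightarrow> F \<subseteq> G \<longrightarrow> G = F)"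

(* The value 0 off S is a convention: the locale Metric_space demands symmetry and
   nonnegativity on the whole type, but its topology only depends on the values on S. *)
definition pdist :: "'a set \<Rightarrow> ('a \<Rightarrow> 'a \<Rightarrow> real) \<Rightarrow> 'a \<Rightarrow> 'a \<Rightarrow> real" where
  "pdist S p x y = (if x \<in> S \<and> y \<in> S then (SUP z\<in>S. \<bar>p x z - p y z\<bar>) else 0)"

definition axiom_I :: "'a set \<Rightarrow> ('a \<Rightarrow> 'a \<Rightarrow> real) \<Rightarrow> bool" where
  "axiom_I S p \<longleftrightarrow> (\<forall>w\<in>S. \<forall>z\<in>S. (p w z = 1 \<longleftrightarrow> w = z) \<and> p w z = p z w)"

definition axiom_II :: "'a set \<Rightarrow> ('a \<Rightarrow> 'a \<Rightarrow> real) \<Rightarrow> bool" where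
  "axiom_II S p \<longleftrightarrow> compact_space (Metric_space.mtopology S (pdist S p))"

(* The frame is summed over as an index set, so no enumeration or countability of it is
   presupposed; the terms are nonnegative, so this agrees with summing any enumeration. *)
definition axiom_III :: "'a set \<Rightarrow> ('a \<Rightarrow> 'a \<Rightarrow> real) \<Rightarrow> bool" where
  "axiom_III S p \<longleftrightarrow> (\<forall>a\<in>S. \<forall>F. frame S p F \<longrightarrow> ((\<lambda>x. p a x) has_sum 1) F)"

definition classical :: "'a set \<Rightarrow> ('a \<Rightarrow> 'a \<Rightarrow> real) \<Rightarrow> bool" where
  "classical S p \<longleftrightarrow> (\<forall>x\<in>S. \<forall>y\<in>S. p x y = 0 \<or> p x y = 1)"

(* M is an arbitrary measure; its total mass may differ from 1 and may be infinite. *)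
definition local_hidden_variable_model ::
    "'a set \<Rightarrow> ('a \<Rightarrow> 'a \<Rightarrow> real) \<Rightarrow> 'l measure \<Rightarrow> ('a \<Rightarrow> 'l set) \<Rightarrow> bool" where
  "local_hidden_variable_model S p M L \<longleftrightarrow>
     (\<forall>x\<in>S. L x \<in> sets M \<and> emeasure M (L x) = 1) \<and>
     (\<forall>x\<in>S. \<forall>y\<in>S. emeasure M (L x \<inter> L y) = ennreal (p x y))"

lemma Metric_space_pdist:
  assumes p: "\<And>x y. x \<in> S \<Longrightarrow> y \<in> S \<Longrightarrow> p x y \<in> {0..1}" and I: "axiom_I S p"
  shows "Metric_space S (pdist S p)"
proof -
  have bdd: "bdd_above ((\<lambda>z. \<bar>p x z - p y z\<bar>) ` S)" if "x \<in> S" "y \<in> S" for x y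
  proof (rule bdd_aboveI2)
    fix z assume "z \<in> S"
    then show "\<bar>p x z - p y z\<bar> \<le> 1" using p[of x z] p[of y z] that by auto
  qed
  have upper: "\<bar>p x z - p y z\<bar> \<le> pdist S p x y" if "x \<in> S" "y \<in> S" "z \<in> S" for x y z
    using that bdd[of x y] by (auto simp: pdist_def intro: cSUP_upper)
  show ?thesis
  proof
    show "0 \<le> pdist S p x y" for x y
    proof (cases "x \<in> S \<and> y \<in> S")
      case True
      then show ?thesis using upper[of x y x] by linarith
    qed (auto simp: pdist_def)
    show "pdist S p x y = pdist S p y x" for x y
      by (auto simp: pdist_def abs_minus_commute)
    show "pdist S p x y = 0 \<longleftrightarrow> x = y" if "x \<in> S" "y \<in> S" for x y
    proof
      assume "pdist S p x y = 0"
      then have "p x x = p y x" using upper[of x y x] that by auto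
      then show "x = y" using I that unfolding axiom_I_def by metis
    next
      assume "x = y"
      moreover have "S \<noteq> {}" using that by auto
      ultimately show "pdist S p x y = 0" by (simp add: pdist_def)
    qed
    show "pdist S p x z \<le> pdist S p x y + pdist S p y z"
      if "x \<in> S" "y \<in> S" "z \<in> S" for x y z
    proof -
      have "\<bar>p x w - p z w\<bar> \<le> pdist S p x y + pdist S p y z" if "w \<in> S" for w
        using upper[of x y w] upper[of y z w] that \<open>x \<in> S\<close> \<open>y \<in> S\<close> \<open>z \<in> S\<close> by linarith
      moreover have "S \<noteq> {}" using that by auto
      ultimately have "(SUP w\<in>S. \<bar>p x w - p z w\<bar>) \<le> pdist S p x y + pdist S p y z"
        by (intro cSUP_least)
      then show ?thesis using that by (simp add: pdist_def[of S p x z])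
    qed
  qed
qed

end

theory Submission imports Defs begin

text \<open>In a hidden variable model all sets have measure 1, so any three of them satisfy Bell's
  inequality \<open>p(x,z) + p(y,z) \<le> 1 + p(x,y)\<close>. Write \<open>(a + b)/2 = \<lambda> c + (1 - \<lambda>) c'\<close> and
  \<open>r = 2\<lambda> - 1\<close>. Evaluation at \<open>c\<close> and \<open>c'\<close> gives \<open>a(c) + b(c) = 1 + r\<close> and
  \<open>a(c') + b(c') = 1 - r\<close>; adding the evaluations at \<open>a\<close> and \<open>b\<close> then gives
  \<open>p(a,b) = r\<^sup>2\<close>. Quantum mechanically, \<open>r = cos \<theta>\<close> and \<open>c\<close> lies halfway between \<open>a\<close> and \<open>b\<close>.
  Bell's inequality for \<open>a, b, c\<close> reads \<open>1 + r \<le> 1 + r\<^sup>2\<close>, which forces \<open>r \<in> {0, 1}\<close>.\<close>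

text \<open>Inclusion-exclusion inside \<open>C\<close>. The additive form avoids subtraction in
  \<open>ennreal\<close>.\<close>

lemma emeasure_Int_add_le:
  assumes "A \<in> sets M" "B \<in> sets M" "C \<in> sets M"
  shows "emeasure M (A \<inter> C) + emeasure M (B \<inter> C) \<le> emeasure M C + emeasure M (A \<inter> B)"
proof -
  have "emeasure M (A \<inter> C) + emeasure M (B \<inter> C)
      = emeasure M ((A \<inter> C) \<union> (B \<inter> C)) + emeasure M ((A \<inter> C) \<inter> (B \<inter> C))"
    using assms by (intro emeasure_Un_Int) auto
  also have "\<dots> \<le> emeasure M C + emeasure M (A \<inter> B)"
    using assms by (intro add_mono emeasure_mono) auto
  finally show ?thesis .
qed

lemma local_hidden_variable_model_Bell:
  assumes model: "local_hidden_variable_model S p M L"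
    and nonneg: "\<And>x y. x \<in> S \<Longrightarrow> y \<in> S \<Longrightarrow> 0 \<le> p x y"
    and S: "x \<in> S" "y \<in> S" "z \<in> S"
  shows "p x z + p y z \<le> 1 + p x y"
proof -
  have "ennreal (p x z) + ennreal (p y z) \<le> 1 + ennreal (p x y)"
    using emeasure_Int_add_le[of "L x" M "L y" "L z"] model S
    by (simp add: local_hidden_variable_model_def)
  \<comment> \<open>\<open>ennreal\<close> sends negative reals to 0, so merging the sums relies on
    \<open>nonneg\<close>.\<close>
  then have "ennreal (p x z + p y z) \<le> ennreal (1 + p x y)"
    using nonneg S by (simp flip: ennreal_1)
  then show ?thesis
    using nonneg[OF S(1,2)] by (subst (asm) ennreal_le_iff) auto
qed

text \<open>The mixture identity evaluated at \<open>c\<close>, \<open>c'\<close>, \<open>a\<close>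
  and \<open>b\<close>, with \<open>t\<close> for \<open>p a b\<close> and \<open>ac\<close> for
  \<open>p a c\<close>, and so on.\<close>

lemma overlap_eq_square:
  fixes l :: real
  assumes "1/2 * (ac + bc) = l" "1/2 * (ac' + bc') = 1 - l"
    and "1/2 * (1 + t) = l * ac + (1 - l) * ac'" "1/2 * (t + 1) = l * bc + (1 - l) * bc'"
  shows "t = (2 * l - 1)\<^sup>2"
proof -
  have "1 + t = l * (ac + bc) + (1 - l) * (ac' + bc')"
    using assms(3,4) unfolding distrib_left by linarith
  also have "\<dots> = l * (2 * l) + (1 - l) * (2 * (1 - l))"
  proof -
    have "ac + bc = 2 * l" "ac' + bc' = 2 * (1 - l)"
      using assms(1,2) by auto
    then show ?thesis by simp
  qed
  finally show ?thesis by (simp add: power2_eq_square algebra_simps)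
qed

theorem proposition4p10:
  fixes S :: "'a set" and p :: "'a \<Rightarrow> 'a \<Rightarrow> real"
  assumes range: "\<And>x y. x \<in> S \<Longrightarrow> y \<in> S \<Longrightarrow> p x y \<in> {0..1}"
    and I: "axiom_I S p"
    and II: "axiom_II S p"
    and III: "axiom_III S p"
    and mix: "\<And>a b. a \<in> S \<Longrightarrow> b \<in> S \<Longrightarrow> a \<noteq> b \<Longrightarrow>
      \<exists>c\<in>S. \<exists>c'\<in>S. \<exists>l::real. orthogonal_in p c c' \<and> 1/2 \<le> l \<and> l \<le> 1 \<and>
        (\<forall>z\<in>S. 1/2 * (p a z + p b z) = l * p c z + (1 - l) * p c' z)"
    and nonclassical: "\<not> classical S p"
  shows "\<not> (\<exists>(M :: 'l measure) L. local_hidden_variable_model S p M L)"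
proof
  assume "\<exists>(M :: 'l measure) L. local_hidden_variable_model S p M L"
  then obtain M :: "'l measure" and L where model: "local_hidden_variable_model S p M L"
    by blast
  have sym: "p x y = p y x" and refl: "p x x = 1" if "x \<in> S" "y \<in> S" for x y
    using I that unfolding axiom_I_def by blast+
  obtain a b where ab: "a \<in> S" "b \<in> S" "p a b \<noteq> 0" "p a b \<noteq> 1"
    using nonclassical unfolding classical_def by blast
  then have "a \<noteq> b" using refl by blast
  then obtain c c' l where c: "c \<in> S" "c' \<in> S" "p c c' = 0" and l: "1/2 \<le> l" "l \<le> 1"
    and mixture: "\<And>z. z \<in> S \<Longrightarrow> 1/2 * (p a z + p b z) = l * p c z + (1 - l) * p c' z"
    using mix[OF ab(1,2)] unfolding orthogonal_in_def by blast
  have at_c: "1/2 * (p a c + p b c) = l" and at_c': "1/2 * (p a c' + p b c') = 1 - l"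
    using mixture[of c] mixture[of c'] c sym[of c' c] refl by auto
  have "p a b = (2 * l - 1)\<^sup>2"
    using mixture[of a] mixture[of b] ab c refl sym[of b a] sym[of c a] sym[of c' a]
      sym[of c b] sym[of c' b]
    by (intro overlap_eq_square[OF at_c at_c']) auto
  moreover have "p a c + p b c \<le> 1 + p a b"
    using range ab c by (intro local_hidden_variable_model_Bell[OF model]) auto
  ultimately have "2 * l - 1 \<le> (2 * l - 1) * (2 * l - 1)"
    using at_c by (simp add: power2_eq_square)
  \<comment> \<open>If \<open>2 * l - 1\<close> is positive, cancelling it leaves
    \<open>1 \<le> 2 * l - 1\<close>, and \<open>l \<le> 1\<close> gives equality.\<close>
  then have "2 * l - 1 = 0 \<or> 2 * l - 1 = 1"
    using l mult_le_cancel_left1[of "2 * l - 1" "2 * l - 1"] by auto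
  then show False
    using \<open>p a b = (2 * l - 1)\<^sup>2\<close> ab by auto
qed

end
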